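(* Let $F,G\in\mathbb{R}^{m\times m}$ with $\det F=0$, and suppose that the pencil $sF-G$ is regular. Let $P,Q\in\mathbb{R}^{m\times m}$ be non-singular matrices bringing $sF-G$ to Weierstrass canonical form, with associated blocks $J_p\in\mathbb{R}^{p\times p}$, $H_q\in\mathbb{R}^{q\times q}$ ($p+q=m$), and let $Q_p\in\mathbb{R}^{m\times p}$ consist of the first $p$ columns of $Q$ (see context). Consider the homogeneous system $$F Y_{k+1}=G Y_k,\qquad k=0,1,2,\dots,$$ with a given non-consistent initial condition $Y_0\in\mathbb{R}^m$, i.e. $Y_0\notin \operatorname{colspan} Q_p$. Perturb the initial condition to a vector $\hat Y_0\in\operatorname{colspan}Q_p$ according to $$\min_{\hat Y_0\in\operatorname{colspan}Q_p}\left\|Y_0-\hat Y_0\right\|_2 .$$ Then this minimum equals $$\left\|Y_0-Q_p(Q_p^*Q_p)^{-1}Q_p^*Y_0\right\|_2 ,$$ and an optimal solution (in the sense defined in the context) of the initial value problem is given by $$\hat Y_k=Q_pJ_p^k(Q_p^*Q_p)^{-1}Q_p^*Y_0,\qquad k\ge 0.$$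
   Context: For $F,G\in\mathbb{R}^{m\times m}$, the matrix pencil $sF-G$ ($s\in\mathbb{C}$) is called regular if $\det(sF-G)$ is not identically zero as a polynomial in $s$. Weierstrass canonical form: for a regular pencil $sF-G$, let $p$ be the sum of the algebraic multiplicities of its finite eigenvalues (the roots of $\det(sF-G)$) and let $q=m-p$ be the algebraic multiplicity of the infinite eigenvalue. The matrices $P,Q\in\mathbb{R}^{m\times m}$ are non-singular and satisfy $$PFQ=\begin{bmatrix} I_p & 0_{p,q}\\ 0_{q,p} & H_q\end{bmatrix},\qquad PGQ=\begin{bmatrix} J_p & 0_{p,q}\\ 0_{q,p} & I_q\end{bmatrix},$$ where $J_p\in\mathbb{R}^{p\times p}$ is a Jordan matrix, $H_q\in\mathbb{R}^{q\times q}$ is nilpotent, and $0_{i,j}$ is the $i\times j$ zero matrix. Write $Q=[\,Q_p\ \ Q_q\,]$ with $Q_p\in\mathbb{R}^{m\times p}$, $Q_q\in\mathbb{R}^{m\times q}$. Conventions: $\operatorname{colspan}Q_p$ is the column space of $Q_p$; $Q_p^*$ is the conjugate transpose (the transpose, for real matrices); $\|\cdot\|_2$ is the Euclidean norm; $J_p^0=I_p$. Consistency: an initial condition $Y_0$ is called consistent if there exists a solution $(Y_k)_{k\ge0}$ of the system having $Y_0$ as its initial value. For the homogeneous system $FY_{k+1}=GY_k$, this is equivalent to $Y_0\in\operatorname{colspan}Q_p$. Optimal solution: for a non-consistent $Y_0$, an optimal solution of the initial value problem is a sequence $(\hat Y_k)_{k\ge0}$ satisfying $F\hat Y_{k+1}=G\hat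 Y_k$ for all $k\ge0$, whose initial value $\hat Y_0$ lies in $\operatorname{colspan}Q_p$ and minimises $\|Y_0-\hat Y_0\|_2$ over all vectors of $\operatorname{colspan}Q_p$. *)

theory Defs
  imports
    Complex_Main
    "Jordan_Normal_Form.Jordan_Normal_Form"
    "Jordan_Normal_Form.VS_Connect"
    "Jordan_Normal_Form.Gauss_Jordan_Elimination"
begin

text \<open>The polynomial \<open>det (s F - G)\<close> is taken over the complex numbers because the
  eigenvalues of the real pencil may be complex.\<close>

definition pencil_det :: "real mat \<Rightarrow> real mat \<Rightarrow> complex poly" where
  "pencil_det F G =
     det ([:0, 1:] \<cdot>\<^sub>m map_mat (\<lambda>x. [:complex_of_real x:]) F
          - map_mat (\<lambda>x. [:complex_of_real x:]) G)"

definition regular_pencil :: "real mat \<Rightarrow> real mat \<Rightarrow> bool" where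
  "regular_pencil F G \<longleftrightarrow> pencil_det F G \<noteq> 0"

definition finite_eigenvalue_multiplicity :: "real mat \<Rightarrow> real mat \<Rightarrow> nat" where
  "finite_eigenvalue_multiplicity F G =
     (\<Sum>s | poly (pencil_det F G) s = 0. Polynomial.order s (pencil_det F G))"

definition is_jordan_matrix :: "real mat \<Rightarrow> bool" where
  "is_jordan_matrix J \<longleftrightarrow> (\<exists>n_as. 0 \<notin> fst ` set n_as \<and> J = jordan_matrix n_as)"

definition nilpotent_mat :: "real mat \<Rightarrow> bool" where
  "nilpotent_mat H \<longleftrightarrow> (\<exists>k. H ^\<^sub>m k = 0\<^sub>m (dim_row H) (dim_row H))"

definition weierstrass_form ::
  "nat \<Rightarrow> nat \<Rightarrow> nat \<Rightarrow> real mat \<Rightarrow> real mat \<Rightarrow> real mat \<Rightarrow> real mat \<Rightarrow> real mat \<Rightarrow> real mat \<Rightarrow> bool"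
where
  "weierstrass_form m p q F G P Q J H \<longleftrightarrow>
     p = finite_eigenvalue_multiplicity F G \<and> p + q = m \<and>
     P \<in> carrier_mat m m \<and> invertible_mat P \<and>
     Q \<in> carrier_mat m m \<and> invertible_mat Q \<and>
     J \<in> carrier_mat p p \<and> is_jordan_matrix J \<and>
     H \<in> carrier_mat q q \<and> nilpotent_mat H \<and>
     P * F * Q = four_block_mat (1\<^sub>m p) (0\<^sub>m p q) (0\<^sub>m q p) H \<and>
     P * G * Q = four_block_mat J (0\<^sub>m p q) (0\<^sub>m q p) (1\<^sub>m q)"

definition first_cols :: "nat \<Rightarrow> real mat \<Rightarrow> real mat" where
  "first_cols p A = mat_of_cols (dim_row A) (take p (cols A))"

abbreviation colspan :: "real mat \<Rightarrow> real vec set" where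
  "colspan A \<equiv> vec_space.col_space (dim_row A) A"

definition norm2 :: "real vec \<Rightarrow> real" where
  "norm2 v = sqrt (v \<bullet> v)"

definition is_solution :: "real mat \<Rightarrow> real mat \<Rightarrow> (nat \<Rightarrow> real vec) \<Rightarrow> bool" where
  "is_solution F G Y \<longleftrightarrow>
     (\<forall>k. Y k \<in> carrier_vec (dim_col F) \<and> F *\<^sub>v Y (Suc k) = G *\<^sub>v Y k)"

definition consistent :: "real mat \<Rightarrow> real mat \<Rightarrow> real vec \<Rightarrow> bool" where
  "consistent F G Y0 \<longleftrightarrow> (\<exists>Y. is_solution F G Y \<and> Y 0 = Y0)"

definition is_minimum_of :: "('a \<Rightarrow> real) \<Rightarrow> 'a set \<Rightarrow> real \<Rightarrow> bool" where
  "is_minimum_of f S r \<longleftrightarrow> r \<in> f ` S \<and> (\<forall>x\<in>S. r \<le> f x)"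

definition optimal_solution ::
  "real mat \<Rightarrow> real mat \<Rightarrow> real mat \<Rightarrow> real vec \<Rightarrow> (nat \<Rightarrow> real vec) \<Rightarrow> bool"
where
  "optimal_solution F G Qp Y0 Y \<longleftrightarrow>
     is_solution F G Y \<and>
     is_arg_min (\<lambda>y. norm2 (Y0 - y)) (\<lambda>y. y \<in> colspan Qp) (Y 0)"

text \<open>Unspecified unless \<open>A\<close> is invertible.\<close>

definition mat_inv :: "real mat \<Rightarrow> real mat" where
  "mat_inv A = the (mat_inverse A)"

end

theory Submission
  imports Defs
begin

text \<open>The homogeneous system is solved in the coordinates given by the first \<open>p\<close> columns of
  \<open>Q\<close>. Comparing the first block columns of the two canonical forms and cancelling \<open>P\<close> gives
  \<open>F * Q\<^sub>p * J = G * Q\<^sub>p\<close> (lemma \<open>pencil_deflating_identity\<close>), so that \<open>Q\<^sub>p J\<^sup>k c\<close> is a solution for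
  every coordinate vector \<open>c\<close>, with initial value \<open>Q\<^sub>p c\<close>.

  It remains to choose \<open>c\<close> so that \<open>Q\<^sub>p c\<close> is as close to \<open>Y\<^sub>0\<close> as possible, which is ordinary linear
  least squares. Since \<open>Q\<close> is non-singular, \<open>Q\<^sub>p\<close> is injective; hence the Gram matrix
  \<open>Q\<^sub>p\<^sup>T Q\<^sub>p\<close> is invertible (lemma \<open>gram_det_nonzero\<close>) and the normal equations have the solution
  \<open>c = (Q\<^sub>p\<^sup>T Q\<^sub>p)\<^sup>-\<^sup>1 Q\<^sub>p\<^sup>T Y\<^sub>0\<close>. The normal equations say that the residual is
  orthogonal to the column space, and Pythagoras shows that such a residual is the shortest one
  (lemma \<open>normal_equations_minimise\<close>).\<close>

section \<open>Real inner products and least squares\<close>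

lemma scalar_prod_self_nonneg: "0 \<le> (v :: real vec) \<bullet> v"
  by (auto simp: scalar_prod_def intro: sum_nonneg)

lemma scalar_prod_self_eq_0:
  fixes v :: "real vec"
  assumes v: "v \<in> carrier_vec n" and z: "v \<bullet> v = 0"
  shows "v = 0\<^sub>v n"
proof -
  have "(\<Sum>i = 0..<n. v $ i * v $ i) = 0"
    using v z by (simp add: scalar_prod_def)
  hence "\<forall>i\<in>{0..<n}. v $ i * v $ i = 0"
    by (subst (asm) sum_nonneg_eq_0_iff) auto
  thus ?thesis using v by (intro eq_vecI) auto
qed

text \<open>If \<open>A\<^sup>T A v = 0\<close>, then \<open>A v\<close> has squared length \<open>v \<bullet> A\<^sup>T A v = 0\<close>, so a kernel vector of the
  Gram matrix is already a kernel vector of \<open>A\<close>.\<close>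

lemma gram_det_nonzero:
  fixes A :: "real mat"
  assumes A: "A \<in> carrier_mat m n"
    and inj: "\<And>x. x \<in> carrier_vec n \<Longrightarrow> A *\<^sub>v x = 0\<^sub>v m \<Longrightarrow> x = 0\<^sub>v n"
  shows "det (A\<^sup>T * A) \<noteq> 0"
proof
  have At: "A\<^sup>T \<in> carrier_mat n m" and AtA: "A\<^sup>T * A \<in> carrier_mat n n"
    using A by auto
  assume "det (A\<^sup>T * A) = 0"
  then obtain v where v: "v \<in> carrier_vec n" "v \<noteq> 0\<^sub>v n" "A\<^sup>T * A *\<^sub>v v = 0\<^sub>v n"
    using det_0_iff_vec_prod_zero_field[OF AtA] by auto
  have Av: "A *\<^sub>v v \<in> carrier_vec m" using A v by auto
  have "(A *\<^sub>v v) \<bullet> (A *\<^sub>v v) = (A\<^sup>T *\<^sub>v (A *\<^sub>v v)) \<bullet> v"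
    using transpose_vec_mult_scalar[OF A v(1) Av] by simp
  also have "A\<^sup>T *\<^sub>v (A *\<^sub>v v) = 0\<^sub>v n"
    using assoc_mult_mat_vec[OF At A v(1)] v(3) by simp
  finally have "(A *\<^sub>v v) \<bullet> (A *\<^sub>v v) = 0" using v(1) by simp
  from inj[OF v(1) scalar_prod_self_eq_0[OF Av this]] v(2) show False by simp
qed

lemma mat_inv_inverse:
  assumes A: "A \<in> carrier_mat n n" and d: "det A \<noteq> 0"
  shows "A * mat_inv A = 1\<^sub>m n" "mat_inv A * A = 1\<^sub>m n" "mat_inv A \<in> carrier_mat n n"
proof -
  obtain B where B: "mat_inverse A = Some B"
    using mat_inverse(1)[OF A, where b = "()"] det_non_zero_imp_unit[OF A d, where b = "()"]
    by (cases "mat_inverse A") auto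
  show "A * mat_inv A = 1\<^sub>m n" "mat_inv A * A = 1\<^sub>m n" "mat_inv A \<in> carrier_mat n n"
    using mat_inverse(2)[OF A B] by (auto simp: mat_inv_def B)
qed

text \<open>The residual \<open>r = b - A c\<close> is orthogonal to every \<open>A z\<close>, and
  \<open>b - A x = r + A (c - x)\<close>, so replacing \<open>c\<close> by \<open>x\<close> adds the squared length of \<open>A (c - x)\<close>.\<close>

lemma normal_equations_minimise:
  fixes A :: "real mat"
  assumes A: "A \<in> carrier_mat m n" and b: "b \<in> carrier_vec m"
    and c: "c \<in> carrier_vec n" and normal: "A\<^sup>T *\<^sub>v (A *\<^sub>v c) = A\<^sup>T *\<^sub>v b"
    and x: "x \<in> carrier_vec n"
  shows "norm2 (b - A *\<^sub>v c) \<le> norm2 (b - A *\<^sub>v x)"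
proof -
  define r where "r = b - A *\<^sub>v c"
  define w where "w = A *\<^sub>v (c - x)"
  have At: "A\<^sup>T \<in> carrier_mat n m" using A by auto
  have Ac: "A *\<^sub>v c \<in> carrier_vec m" using A c by auto
  have r: "r \<in> carrier_vec m" unfolding r_def using b Ac by auto
  have w: "w \<in> carrier_vec m" unfolding w_def using A c x by auto
  have "A\<^sup>T *\<^sub>v r = 0\<^sub>v n"
    unfolding r_def using mult_minus_distrib_mat_vec[OF At b Ac] normal At b by simp
  hence orth: "r \<bullet> w = 0"
    unfolding w_def using transpose_vec_mult_scalar[OF A _ r, of "c - x"] c x
      comm_scalar_prod[OF r w] w_def
    by simp
  have "w = A *\<^sub>v c - A *\<^sub>v x"
    unfolding w_def by (rule mult_minus_distrib_mat_vec[OF A c x])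
  hence split: "b - A *\<^sub>v x = r + w"
    unfolding r_def using b A c x by (intro eq_vecI) auto
  have "(r + w) \<bullet> (r + w) = r \<bullet> r + w \<bullet> w"
    using r w orth comm_scalar_prod[OF r w]
    by (simp add: add_scalar_prod_distrib[OF r w] scalar_prod_add_distrib[where n = m])
  thus ?thesis
    unfolding norm2_def split r_def[symmetric]
    using scalar_prod_self_nonneg[of w] by simp
qed

section \<open>Solutions from the finite part of the canonical form\<close>

text \<open>This is the inclusion of the first \<open>p\<close> coordinates. It is padded with two empty blocks
  so that it can be multiplied blockwise with the canonical forms.\<close>

definition first_embedding :: "nat \<Rightarrow> nat \<Rightarrow> real mat" where
  "first_embedding p q = four_block_mat (1\<^sub>m p) (0\<^sub>m p 0) (0\<^sub>m q p) (0\<^sub>m q 0)"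

lemma first_embedding_carrier: "first_embedding p q \<in> carrier_mat (p + q) p"
  unfolding first_embedding_def by (rule carrier_matI) auto

lemma first_cols_eq_mult:
  assumes Q: "Q \<in> carrier_mat (p + q) (p + q)"
  shows "first_cols p Q = Q * first_embedding p q"
proof (rule eq_matI)
  fix i j
  assume "i < dim_row (Q * first_embedding p q)" "j < dim_col (Q * first_embedding p q)"
  hence ij: "i < p + q" "j < p"
    using Q first_embedding_carrier[of p q] by auto
  have "col (first_embedding p q) j = unit_vec (p + q) j"
    using ij unfolding first_embedding_def by (intro eq_vecI) (auto simp: unit_vec_def)
  hence "(Q * first_embedding p q) $$ (i, j) = row Q i \<bullet> unit_vec (p + q) j"
    using ij Q first_embedding_carrier[of p q] by simp
  thus "first_cols p Q $$ (i, j) = (Q * first_embedding p q) $$ (i, j)"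
    using ij Q by (simp add: first_cols_def mat_of_cols_index)
qed (use Q first_embedding_carrier[of p q] in \<open>auto simp: first_cols_def\<close>)

lemma block_diag_mult_first_embedding:
  assumes A: "A \<in> carrier_mat p p" and D: "D \<in> carrier_mat q q"
  shows "four_block_mat A (0\<^sub>m p q) (0\<^sub>m q p) D * first_embedding p q = first_embedding p q * A"
proof -
  have "four_block_mat A (0\<^sub>m p q) (0\<^sub>m q p) D * first_embedding p q
      = four_block_mat A (0\<^sub>m p 0) (0\<^sub>m q p) (0\<^sub>m q 0)"
    unfolding first_embedding_def using A D
    by (subst mult_four_block_mat[where ?nr1.0 = p and ?n1.0 = p and ?n2.0 = q and ?nr2.0 = q
          and ?nc1.0 = p and ?nc2.0 = 0]) auto
  also have "\<dots> = first_embedding p q * four_block_mat A (0\<^sub>m p 0) (0\<^sub>m 0 p) (0\<^sub>m 0 0)"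
    unfolding first_embedding_def using A
    by (subst mult_four_block_mat[where ?nr1.0 = p and ?n1.0 = p and ?n2.0 = 0 and ?nr2.0 = q
          and ?nc1.0 = p and ?nc2.0 = 0]) auto
  also have "four_block_mat A (0\<^sub>m p 0) (0\<^sub>m 0 p) (0\<^sub>m 0 0) = A"
    using A by (intro eq_matI) auto
  finally show ?thesis .
qed

lemma invertible_matE:
  assumes "invertible_mat A" and A: "A \<in> carrier_mat n n"
  obtains B where "B \<in> carrier_mat n n" "B * A = 1\<^sub>m n"
proof -
  obtain B where "A * B = 1\<^sub>m n" and BA: "B * A = 1\<^sub>m (dim_row B)"
    using assms unfolding invertible_mat_def inverts_mat_def by auto
  hence "dim_col B = n" "dim_row B = n"
    using A BA by (metis index_mult_mat(3) index_one_mat(3))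
      (metis A BA carrier_matD(2) index_mult_mat(3) index_one_mat(3))
  thus ?thesis using that[of B] BA by auto
qed

lemma invertible_mat_cancel_left:
  assumes "invertible_mat P" and P: "P \<in> carrier_mat n n"
    and X: "X \<in> carrier_mat n k" and Y: "Y \<in> carrier_mat n k"
    and eq: "P * X = P * Y"
  shows "X = Y"
proof -
  obtain B where B: "B \<in> carrier_mat n n" "B * P = 1\<^sub>m n"
    using invertible_matE[OF assms(1) P] by blast
  have "X = B * (P * X)" "Y = B * (P * Y)"
    using B X Y by (simp_all add: assoc_mult_mat[OF B(1) P, symmetric])
  thus ?thesis using eq by simp
qed

lemma first_cols_injective:
  assumes "invertible_mat Q" and Q: "Q \<in> carrier_mat (p + q) (p + q)"
    and x: "x \<in> carrier_vec p" and z: "first_cols p Q *\<^sub>v x = 0\<^sub>v (p + q)"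
  shows "x = 0\<^sub>v p"
proof -
  let ?E = "first_embedding p q"
  note E = first_embedding_carrier[of p q]
  obtain B where B: "B \<in> carrier_mat (p + q) (p + q)" "B * Q = 1\<^sub>m (p + q)"
    using invertible_matE[OF assms(1) Q] by blast
  have Ex: "?E *\<^sub>v x \<in> carrier_vec (p + q)" using E x by auto
  have "?E *\<^sub>v x = B *\<^sub>v (Q *\<^sub>v (?E *\<^sub>v x))"
    using B Ex by (simp add: assoc_mult_mat_vec[OF B(1) Q, symmetric])
  also have "Q *\<^sub>v (?E *\<^sub>v x) = 0\<^sub>v (p + q)"
    using z Q E x by (simp add: first_cols_eq_mult)
  also have "B *\<^sub>v 0\<^sub>v (p + q) = 0\<^sub>v (p + q)" using B by auto
  finally have zero: "?E *\<^sub>v x = 0\<^sub>v (p + q)" .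
  show ?thesis
  proof (rule eq_vecI)
    fix i assume "i < dim_vec (0\<^sub>v p :: real vec)"
    hence i: "i < p" by simp
    have "row ?E i = unit_vec p i"
      using i unfolding first_embedding_def by (intro eq_vecI) (auto simp: unit_vec_def)
    hence "x $ i = (?E *\<^sub>v x) $ i" using i x E by simp
    thus "x $ i = 0\<^sub>v p $ i" using i zero by simp
  qed (use x in auto)
qed

text \<open>After multiplication by \<open>P\<close>, which can be cancelled, both sides become \<open>first_embedding p q * J\<close>: for \<open>F\<close> because its first diagonal
  block is the identity, for \<open>G\<close> because it is \<open>J\<close>.\<close>

lemma pencil_deflating_identity:
  assumes F: "F \<in> carrier_mat m m" and G: "G \<in> carrier_mat m m"
    and W: "weierstrass_form m p q F G P Q J H"
  shows "F * first_cols p Q * J = G * first_cols p Q"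
proof -
  let ?E = "first_embedding p q"
  from W have m: "m = p + q" and P: "P \<in> carrier_mat m m" and iP: "invertible_mat P"
    and Q: "Q \<in> carrier_mat m m" and J: "J \<in> carrier_mat p p" and H: "H \<in> carrier_mat q q"
    and PFQ: "P * F * Q = four_block_mat (1\<^sub>m p) (0\<^sub>m p q) (0\<^sub>m q p) H"
    and PGQ: "P * G * Q = four_block_mat J (0\<^sub>m p q) (0\<^sub>m q p) (1\<^sub>m q)"
    unfolding weierstrass_form_def by auto
  have E: "?E \<in> carrier_mat m p" unfolding m by (rule first_embedding_carrier)
  have Qp: "first_cols p Q = Q * ?E" using Q unfolding m by (rule first_cols_eq_mult)
  have pull: "P * (X * (Q * ?E)) = P * X * Q * ?E" if X: "X \<in> carrier_mat m m" for X
  proof -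
    have QE: "Q * ?E \<in> carrier_mat m p" and PX: "P * X \<in> carrier_mat m m"
      using P X Q E by auto
    show ?thesis
      unfolding assoc_mult_mat[OF PX Q E] assoc_mult_mat[OF P X QE] ..
  qed
  have "P * (F * (Q * ?E) * J) = P * (F * (Q * ?E)) * J"
    using P F Q E J by (intro assoc_mult_mat[symmetric]) auto
  also have "\<dots> = ?E * J"
    unfolding pull[OF F] PFQ using H E
    by (simp add: block_diag_mult_first_embedding[OF one_carrier_mat H])
  also have "\<dots> = P * (G * (Q * ?E))"
    unfolding pull[OF G] PGQ using J by (simp add: block_diag_mult_first_embedding)
  finally have eq: "P * (F * (Q * ?E) * J) = P * (G * (Q * ?E))" .
  show ?thesis
    unfolding Qp
    by (rule invertible_mat_cancel_left[OF iP P _ _ eq]) (use F G Q E J in auto)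
qed

text \<open>Multiplying the intertwining relation \<open>F A J = G A\<close> on the right by powers of \<open>J\<close> turns
  every coordinate vector into a solution.\<close>

lemma deflating_solution:
  assumes F: "F \<in> carrier_mat m m" and G: "G \<in> carrier_mat m m"
    and A: "A \<in> carrier_mat m p" and J: "J \<in> carrier_mat p p"
    and FAJ: "F * A * J = G * A" and c: "c \<in> carrier_vec p"
  shows "is_solution F G (\<lambda>k. A * J ^\<^sub>m k *\<^sub>v c)"
  unfolding is_solution_def
proof (intro allI conjI)
  fix k
  have Jk: "J ^\<^sub>m j \<in> carrier_mat p p" for j using J by (rule pow_carrier_mat)
  show "A * J ^\<^sub>m k *\<^sub>v c \<in> carrier_vec (dim_col F)"
    using mult_mat_vec_carrier[OF mult_carrier_mat[OF A Jk] c] F by simp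
  have comm: "J ^\<^sub>m Suc k = J * J ^\<^sub>m k"
  proof (induction k)
    case (Suc k)
    have "J ^\<^sub>m Suc (Suc k) = J * J ^\<^sub>m k * J" using Suc by simp
    also have "\<dots> = J * J ^\<^sub>m Suc k" using assoc_mult_mat[OF J Jk J] by simp
    finally show ?case .
  qed (use J in simp)
  have "F * (A * J ^\<^sub>m Suc k) = F * (A * (J * J ^\<^sub>m k))" unfolding comm ..
  also have "\<dots> = F * A * J * J ^\<^sub>m k"
    unfolding assoc_mult_mat[OF A J Jk, symmetric]
      assoc_mult_mat[OF F mult_carrier_mat[OF A J] Jk, symmetric]
      assoc_mult_mat[OF F A J, symmetric] ..
  also have "\<dots> = G * (A * J ^\<^sub>m k)"
    unfolding FAJ using G A Jk by (intro assoc_mult_mat) auto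
  finally have step: "F * (A * J ^\<^sub>m Suc k) = G * (A * J ^\<^sub>m k)" .
  have "F *\<^sub>v (A * J ^\<^sub>m Suc k *\<^sub>v c) = F * (A * J ^\<^sub>m Suc k) *\<^sub>v c"
    by (rule assoc_mult_mat_vec[OF F mult_carrier_mat[OF A Jk] c, symmetric])
  also have "\<dots> = G *\<^sub>v (A * J ^\<^sub>m k *\<^sub>v c)"
    unfolding step by (rule assoc_mult_mat_vec[OF G mult_carrier_mat[OF A Jk] c])
  finally show "F *\<^sub>v (A * J ^\<^sub>m Suc k *\<^sub>v c) = G *\<^sub>v (A * J ^\<^sub>m k *\<^sub>v c)" .
qed

section \<open>The optimal solution\<close>

theorem theorem3p1:
  fixes F G P Q J H Qp :: "real mat" and Y0 :: "real vec" and m p q :: nat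
  assumes "F \<in> carrier_mat m m" and "G \<in> carrier_mat m m"
    and "det F = 0"
    and "regular_pencil F G"
    and "weierstrass_form m p q F G P Q J H"
    and "Qp = first_cols p Q"
    and "Y0 \<in> carrier_vec m"
    and "\<not> consistent F G Y0"
  shows "invertible_mat (Qp\<^sup>T * Qp) \<and>
    is_minimum_of (\<lambda>y. norm2 (Y0 - y)) (colspan Qp)
      (norm2 (Y0 - Qp * mat_inv (Qp\<^sup>T * Qp) * Qp\<^sup>T *\<^sub>v Y0)) \<and>
    optimal_solution F G Qp Y0
      (\<lambda>k. Qp * J ^\<^sub>m k * mat_inv (Qp\<^sup>T * Qp) * Qp\<^sup>T *\<^sub>v Y0)"
proof -
  let ?A = "Qp\<^sup>T * Qp"
  let ?M = "mat_inv ?A"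
  note F = assms(1) and G = assms(2) and W = assms(5) and Y0 = assms(7)
  from W have m: "m = p + q" and Q: "Q \<in> carrier_mat m m" and iQ: "invertible_mat Q"
    and J: "J \<in> carrier_mat p p"
    unfolding weierstrass_form_def by auto
  have Qp: "Qp \<in> carrier_mat m p"
    using Q first_embedding_carrier[of p q] unfolding assms(6) m by (auto simp: first_cols_eq_mult)
  hence Qt: "Qp\<^sup>T \<in> carrier_mat p m" and A: "?A \<in> carrier_mat p p" by auto
  have "det ?A \<noteq> 0"
    using first_cols_injective[OF iQ, of p q] Q
    by (intro gram_det_nonzero[OF Qp]) (auto simp: m assms(6))
  note M = mat_inv_inverse[OF A this]
  have "square_mat ?A" "dim_row ?A = p" "dim_row ?M = p"
    using A M(3) by auto
  hence inv: "invertible_mat ?A"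
    unfolding invertible_mat_def inverts_mat_def using M(1,2) by metis
  define c where "c = ?M *\<^sub>v (Qp\<^sup>T *\<^sub>v Y0)"
  have QtY: "Qp\<^sup>T *\<^sub>v Y0 \<in> carrier_vec p" using Qt Y0 by auto
  hence c: "c \<in> carrier_vec p" unfolding c_def using M by auto
  have coords: "B * ?M * Qp\<^sup>T *\<^sub>v Y0 = B *\<^sub>v c" if B: "B \<in> carrier_mat m p" for B
    unfolding c_def assoc_mult_mat_vec[OF mult_carrier_mat[OF B M(3)] Qt Y0]
      assoc_mult_mat_vec[OF B M(3) QtY] ..
  have "Qp\<^sup>T *\<^sub>v (Qp *\<^sub>v c) = ?A *\<^sub>v (?M *\<^sub>v (Qp\<^sup>T *\<^sub>v Y0))"
    using assoc_mult_mat_vec[OF Qt Qp c] by (simp add: c_def)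
  also have "\<dots> = Qp\<^sup>T *\<^sub>v Y0"
    using assoc_mult_mat_vec[OF A M(3) QtY] M(1) QtY by simp
  finally have normal: "Qp\<^sup>T *\<^sub>v (Qp *\<^sub>v c) = Qp\<^sup>T *\<^sub>v Y0" .
  have span: "colspan Qp = {Qp *\<^sub>v x | x. x \<in> carrier_vec p}"
    using Qp vec_space.col_space_eq[of Qp "dim_row Qp" p] by auto
  have mem: "Qp *\<^sub>v c \<in> colspan Qp" unfolding span using c by auto
  have le: "norm2 (Y0 - Qp *\<^sub>v c) \<le> norm2 (Y0 - y)" if "y \<in> colspan Qp" for y
    using that normal_equations_minimise[OF Qp Y0 c normal] unfolding span by auto
  have Yk: "(\<lambda>k. Qp * J ^\<^sub>m k * ?M * Qp\<^sup>T *\<^sub>v Y0) = (\<lambda>k. Qp * J ^\<^sub>m k *\<^sub>v c)"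
    by (intro ext coords mult_carrier_mat[OF Qp] pow_carrier_mat J)
  have sol: "is_solution F G (\<lambda>k. Qp * J ^\<^sub>m k *\<^sub>v c)"
    using pencil_deflating_identity[OF F G W] assms(6)
    by (intro deflating_solution[OF F G Qp J _ c]) auto
  have "Qp * J ^\<^sub>m 0 = Qp" using Qp J by simp
  hence "optimal_solution F G Qp Y0 (\<lambda>k. Qp * J ^\<^sub>m k *\<^sub>v c)"
    unfolding optimal_solution_def is_arg_min_def using sol mem le
    by (auto simp: not_less)
  moreover have "is_minimum_of (\<lambda>y. norm2 (Y0 - y)) (colspan Qp) (norm2 (Y0 - Qp *\<^sub>v c))"
    unfolding is_minimum_of_def using mem le by auto
  ultimately show ?thesis
    using inv unfolding Yk coords[OF Qp] by simp
qed

end
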